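(* Every rank-$3$ matroid has a freest tensor product with every uniform matroid. That is, for every matroid $M$ of rank $3$ and every uniform matroid $U_{k,n}$, there exists a tensor product $P\in M\otimes U_{k,n}$ such that every set that is independent in some tensor product $P'\in M\otimes U_{k,n}$ is also independent in $P$.
   Context: "Matroid" means a matroid on a finite ground set, written as (ground set, rank function). $U_{k,n}$ is the uniform matroid of rank $k$ on $n$ elements, with rank function $X\mapsto\min\{|X|,k\}$. A matroid $P=(S_1\times S_2,r)$ is a tensor product of $M_1=(S_1,r_1)$ and $M_2=(S_2,r_2)$ if $r(X\times Y)=r_1(X)\cdot r_2(Y)$ for all $X\subseteq S_1$, $Y\subseteq S_2$; the set of all tensor products is denoted $M_1\otimes M_2$. *)

theory Defs
  imports Main
begin

text \<open>
  A pair of a ground set and a rank function. The rank function is total on the type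
  \<^typ>\<open>'a set\<close>; only its values on subsets of the ground set are meaningful, and every notion
  below consults only those values.
\<close>
type_synonym 'a ranked_set = "'a set \<times> ('a set \<Rightarrow> nat)"

abbreviation ground :: "'a ranked_set \<Rightarrow> 'a set" where
  "ground M \<equiv> fst M"

abbreviation rk :: "'a ranked_set \<Rightarrow> 'a set \<Rightarrow> nat" where
  "rk M \<equiv> snd M"

locale matroid =
  fixes M :: "'a ranked_set"
  assumes finite_ground: "finite (ground M)"
    and rk_le_card: "X \<subseteq> ground M \<Longrightarrow> rk M X \<le> card X"
    and rk_mono: "X \<subseteq> Y \<Longrightarrow> Y \<subseteq> ground M \<Longrightarrow> rk M X \<le> rk M Y"
    and rk_submodular: "X \<subseteq> ground M \<Longrightarrow> Y \<subseteq> ground M \<Longrightarrow>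
      rk M (X \<union> Y) + rk M (X \<inter> Y) \<le> rk M X + rk M Y"

definition matroid_rank :: "'a ranked_set \<Rightarrow> nat" where
  "matroid_rank M = rk M (ground M)"

definition indep :: "'a ranked_set \<Rightarrow> 'a set \<Rightarrow> bool" where
  "indep M X \<longleftrightarrow> X \<subseteq> ground M \<and> rk M X = card X"

text \<open>
  \<open>uniform_matroid k n N\<close>: \<open>N\<close> is a copy of \<open>U\<^sub>k\<^sub>,\<^sub>n\<close> on an arbitrary ground set with \<open>n\<close>
  elements. Requiring the rank to be \<open>k\<close> amounts to \<open>k \<le> n\<close>.
\<close>
definition uniform_matroid :: "nat \<Rightarrow> nat \<Rightarrow> 'a ranked_set \<Rightarrow> bool" where
  "uniform_matroid k n N \<longleftrightarrow>
     matroid N \<and> card (ground N) = n \<and> matroid_rank N = k \<and>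
     (\<forall>X \<subseteq> ground N. rk N X = min (card X) k)"

definition tensor_products ::
    "'a ranked_set \<Rightarrow> 'b ranked_set \<Rightarrow> ('a \<times> 'b) ranked_set set" (infixl "\<otimes>" 70) where
  "M \<otimes> N = {P. matroid P \<and> ground P = ground M \<times> ground N \<and>
     (\<forall>X Y. X \<subseteq> ground M \<longrightarrow> Y \<subseteq> ground N \<longrightarrow> rk P (X \<times> Y) = rk M X * rk N Y)}"

definition freest_tensor_product ::
    "'a ranked_set \<Rightarrow> 'b ranked_set \<Rightarrow> ('a \<times> 'b) ranked_set \<Rightarrow> bool" where
  "freest_tensor_product M N P \<longleftrightarrow>
     P \<in> M \<otimes> N \<and> (\<forall>P' \<in> M \<otimes> N. \<forall>X. indep P' X \<longrightarrow> indep P X)"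

lemma uniform_matroid_standard:
  assumes "k \<le> n"
  shows "uniform_matroid k n ({..<n}, \<lambda>X. min (card X) k)"
proof -
  have "min (card (X \<union> Y)) k + min (card (X \<inter> Y)) k \<le> min (card X) k + min (card Y) k"
    if "X \<subseteq> {..<n}" "Y \<subseteq> {..<n}" for X Y :: "nat set"
  proof -
    have fin: "finite X" "finite Y"
      using that finite_subset by auto
    have "card (X \<inter> Y) \<le> card X" "card (X \<inter> Y) \<le> card Y"
      using fin by (auto intro: card_mono)
    with card_Un_Int[OF fin] show ?thesis
      by (auto simp: min_def)
  qed
  moreover have "min (card X) k \<le> min (card Y) k" if "X \<subseteq> Y" "Y \<subseteq> {..<n}" for X Y :: "nat set"
    using card_mono[of Y X] that finite_subset[of Y "{..<n}"] by auto
  ultimately have "matroid ({..<n}, \<lambda>X. min (card X) k)"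
    unfolding matroid_def by auto
  then show ?thesis
    using assms by (auto simp: uniform_matroid_def matroid_rank_def)
qed

end

theory Submission imports Defs begin

text \<open>
  Let \<open>M\<close> have ground set \<open>S\<close> and rank function \<open>r\<close>, let \<open>N\<close> be \<open>U\<^sub>k\<^sub>,\<^sub>n\<close> on \<open>T\<close>, and split a set
  \<open>X \<subseteq> S \<times> T\<close> into its slices \<open>X\<^sub>t \<subseteq> S\<close>. Fix \<open>F \<subseteq> S\<close>. In any tensor product the set \<open>F \<times> T\<close> has
  rank \<open>k * r F\<close>, and adding the elements of one column \<open>t\<close> to it raises the rank by at most
  \<open>r (X\<^sub>t \<union> F) - r F\<close>. So the rank of \<open>X\<close> is at most
  \<open>k * r F + (\<Sum>t\<in>T. r (X\<^sub>t \<union> F) - r F)\<close>. If the minimum of all such bounds is a matroid rank function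
  with the right values on rectangles, it is the rank function of the freest tensor product.

  Two bounds, given by flats \<open>F\<close> and \<open>G\<close>, uncross into those of \<open>F \<union> G\<close> and \<open>F \<inter> G\<close> whenever
  \<open>(F, G)\<close> is a modular pair. In rank 3 this only fails for two lines without a common point
  (\<open>flats_modular_or_skew\<close>). The remedy is to give every such pair of lines an ideal intersection
  point: the one-element extension of \<open>M\<close> by the modular cut consisting of the two lines and \<open>S\<close>.
  Its rank function \<open>A \<mapsto> r (A \<union> {point})\<close> is \<open>meet_rk\<close>, and the point yields one more bound of the same
  shape. This bound is still forced in every tensor product, since it follows from submodularity
  applied to \<open>X \<union> L \<times> T\<close> and \<open>X \<union> L' \<times> T\<close> (\<open>rk_le_cost_meet\<close>).

  One would expect the process to continue, since the ideal points span new lines, which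
  have new intersections, and so on up to a projective plane containing \<open>M\<close>. It stops because a new
  line carries elements of \<open>S\<close> of rank at most 1 only, and its bound is never smaller than all of
  those already there (\<open>free_rk_le_line\<close>). With this, all pairs of bounds uncross
  (\<open>uncross_flats\<close>, \<open>uncross_meet_flat\<close>, \<open>uncross_meets\<close>), so the minimum \<open>free_rk\<close> is submodular.
\<close>

section \<open>Slices of a subset of a product\<close>

definition slice :: "('a \<times> 'b) set \<Rightarrow> 'b \<Rightarrow> 'a set" where
  "slice X t = {s. (s, t) \<in> X}"

lemma slice_simps [simp]:
  "slice (X \<union> Y) t = slice X t \<union> slice Y t"
  "slice (X \<inter> Y) t = slice X t \<inter> slice Y t"
  "slice (A \<times> B) t = (if t \<in> B then A else {})"
  "slice {} t = {}"
  by (auto simp: slice_def)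

lemma slice_subset: "X \<subseteq> A \<times> B \<Longrightarrow> slice X t \<subseteq> A"
  by (auto simp: slice_def)

lemma slice_mono: "X \<subseteq> Y \<Longrightarrow> slice X t \<subseteq> slice Y t"
  by (auto simp: slice_def)

lemma card_eq_sum_slices:
  assumes "X \<subseteq> A \<times> B" "finite A" "finite B"
  shows "card X = (\<Sum>t\<in>B. card (slice X t))"
proof -
  have "X = prod.swap ` (SIGMA t:B. slice X t)"
    using assms(1) by (force simp: slice_def)
  then have "card X = card (SIGMA t:B. slice X t)"
    by (metis card_image inj_swap)
  also have "\<dots> = (\<Sum>t\<in>B. card (slice X t))"
    using assms slice_subset[OF assms(1)] finite_subset by (intro card_SigmaI) blast+
  finally show ?thesis .
qed

section \<open>Flats of a rank-3 matroid\<close>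

locale rank3_matroid = matroid M for M :: "'a ranked_set" +
  assumes rank3: "matroid_rank M = 3"
begin

abbreviation S where "S \<equiv> ground M"
abbreviation r where "r \<equiv> rk M"

lemma r_ground: "r S = 3"
  using rank3 by (simp add: matroid_rank_def)

lemma r_le_3: "A \<subseteq> S \<Longrightarrow> r A \<le> 3"
  using rk_mono[of A S] r_ground by simp

lemma r_empty [simp]: "r {} = 0"
  using rk_le_card[of "{}"] by simp

lemma r_submodular_le:
  assumes "A \<subseteq> S" "B \<subseteq> S" "C \<subseteq> A \<inter> B" "D \<subseteq> A \<union> B"
  shows "r D + r C \<le> r A + r B"
proof -
  have "r D \<le> r (A \<union> B)" "r C \<le> r (A \<inter> B)"
    using assms by (auto intro!: rk_mono)
  with rk_submodular[of A B] assms show ?thesis by linarith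
qed

definition flat :: "'a set \<Rightarrow> bool" where
  "flat F \<longleftrightarrow> F \<subseteq> S \<and> (\<forall>Z \<subseteq> S. r (F \<union> Z) = r F \<longrightarrow> Z \<subseteq> F)"

lemma flat_subset: "flat F \<Longrightarrow> F \<subseteq> S"
  by (simp add: flat_def)

lemma flatD:
  assumes "flat F" "Z \<subseteq> S" "r (F \<union> Z) \<le> r F"
  shows "Z \<subseteq> F"
proof -
  have "r F \<le> r (F \<union> Z)"
    using assms by (intro rk_mono) (auto simp: flat_def)
  with assms show ?thesis by (auto simp: flat_def)
qed

lemma flat_hull:
  assumes "A \<subseteq> S"
  obtains F where "flat F" "A \<subseteq> F" "r F = r A"
proof -
  define H where "H = {Z. A \<subseteq> Z \<and> Z \<subseteq> S \<and> r Z = r A}"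
  have "H \<subseteq> Pow S" by (auto simp: H_def)
  then have "finite H" using finite_ground finite_subset by blast
  moreover have "A \<in> H" using assms by (simp add: H_def)
  ultimately obtain F where F: "F \<in> H" "\<And>Z. Z \<in> H \<Longrightarrow> F \<subseteq> Z \<Longrightarrow> F = Z"
    using finite_has_maximal2[of H A] by metis
  have "flat F"
    unfolding flat_def
  proof (intro conjI allI impI)
    fix Z assume Z: "Z \<subseteq> S" "r (F \<union> Z) = r F"
    have "F \<union> Z \<in> H" using F(1) Z by (auto simp: H_def)
    then have "F = F \<union> Z" using F(2) by blast
    then show "Z \<subseteq> F" by blast
  qed (use F(1) in \<open>auto simp: H_def\<close>)
  with F(1) that show thesis by (simp add: H_def)
qed

lemma r_Un_cong:
  assumes "A \<subseteq> F" "F \<subseteq> S" "r F = r A" "B \<subseteq> S"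
  shows "r (B \<union> F) = r (B \<union> A)"
proof -
  have "r (B \<union> F) + r A \<le> r (B \<union> A) + r F"
    using assms by (intro r_submodular_le) auto
  moreover have "r (B \<union> A) \<le> r (B \<union> F)"
    using assms by (intro rk_mono) auto
  ultimately show ?thesis using assms by linarith
qed

section \<open>Ideal intersection points of disjoint lines\<close>

definition spans :: "'a set \<Rightarrow> 'a set \<Rightarrow> bool" where
  "spans A L \<longleftrightarrow> r (A \<union> L) = r A"

lemma spans_mono:
  assumes "spans A L" "A \<subseteq> B" "B \<subseteq> S" "L \<subseteq> S"
  shows "spans B L"
proof -
  have "r (B \<union> L) + r A \<le> r B + r (A \<union> L)"
    using assms by (intro r_submodular_le) auto
  moreover have "r B \<le> r (B \<union> L)" using assms by (intro rk_mono) auto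
  ultimately show ?thesis using assms by (auto simp: spans_def)
qed

text \<open>
  The two lines may share loops, hence rank 0 of the intersection instead of emptiness.
\<close>
definition skew_lines :: "'a set \<Rightarrow> 'a set \<Rightarrow> bool" where
  "skew_lines L L' \<longleftrightarrow> flat L \<and> flat L' \<and> r L = 2 \<and> r L' = 2 \<and> r (L \<inter> L') = 0"

text \<open>
  The rank of \<open>A\<close> together with the ideal common point of the lines \<open>L\<close> and \<open>L'\<close>: this point lies in
  the closure of exactly those sets that span one of the two lines.
\<close>
definition meet_rk :: "'a set \<Rightarrow> 'a set \<Rightarrow> 'a set \<Rightarrow> nat" where
  "meet_rk L L' A = (if spans A L \<or> spans A L' then r A else r A + 1)"

lemma meet_rk_commute: "meet_rk L L' = meet_rk L' L"
  by (auto simp: meet_rk_def)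

lemma skew_lines_commute: "skew_lines L L' \<longleftrightarrow> skew_lines L' L"
  by (auto simp: skew_lines_def Int_commute)

lemma r_le_meet_rk: "r A \<le> meet_rk L L' A"
  by (simp add: meet_rk_def)

lemma skew_lines_subset:
  assumes "skew_lines L L'" shows "L \<subseteq> S" "L' \<subseteq> S"
  using assms by (auto simp: skew_lines_def flat_subset)

lemma skew_lines_span:
  assumes "skew_lines L L'" shows "r (L \<union> L') = 3"
proof -
  have "\<not> L' \<subseteq> L" using assms by (auto simp: skew_lines_def Int_absorb1)
  then have "r (L \<union> L') > r L"
    using flatD[of L L'] skew_lines_subset[OF assms] assms by (force simp: skew_lines_def)
  moreover have "r (L \<union> L') \<le> 3"
    using skew_lines_subset[OF assms] by (intro r_le_3) auto
  ultimately show ?thesis using assms by (simp add: skew_lines_def)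
qed

lemma spans_line_rank:
  assumes "spans A L" "A \<subseteq> S" "L \<subseteq> S" "r L = 2"
  shows "2 \<le> r A"
  using assms rk_mono[of L "A \<union> L"] by (simp add: spans_def)

lemma spans_line_subset:
  assumes "spans A L" "A \<subseteq> S" "flat L" "r L = 2" "r A = 2"
  shows "A \<subseteq> L"
proof (rule flatD[OF assms(3,2)])
  show "r (L \<union> A) \<le> r L" using assms by (simp add: spans_def Un_commute)
qed

lemma meet_rk_empty [simp]:
  assumes "skew_lines L L'" shows "meet_rk L L' {} = 1"
  using assms by (auto simp: meet_rk_def spans_def skew_lines_def)

lemma meet_rk_mono:
  assumes "skew_lines L L'" "A \<subseteq> B" "B \<subseteq> S"
  shows "meet_rk L L' A \<le> meet_rk L L' B"
proof (cases "r A = r B")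
  case False
  then show ?thesis using rk_mono[of A B] assms by (auto simp: meet_rk_def)
next
  case True
  have "spans A Z" if "spans B Z" "Z \<subseteq> S" for Z
  proof -
    have "r (A \<union> Z) \<le> r (B \<union> Z)" "r A \<le> r (A \<union> Z)"
      using assms that by (auto intro!: rk_mono)
    with that True show ?thesis by (simp add: spans_def)
  qed
  with True skew_lines_subset[OF assms(1)] show ?thesis by (auto simp: meet_rk_def)
qed

text \<open>
  The quotient property of a one-element extension: once the ideal point is in the closure of \<open>A\<close>,
  it stays in the closure of every larger set.
\<close>

lemma meet_rk_quotient:
  assumes "skew_lines L L'" "A \<subseteq> S" "B \<subseteq> S"
  shows "meet_rk L L' (A \<union> B) + r (A \<inter> B) \<le> meet_rk L L' A + r B"
  using rk_submodular[of A B] assms spans_mono[of A _ "A \<union> B"] skew_lines_subset[OF assms(1)]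
  by (auto simp: meet_rk_def)

text \<open>
  The sets that span \<open>L\<close> or \<open>L'\<close> form a modular cut. The only critical case is that both \<open>A\<close> and
  \<open>B\<close> span one of the lines while \<open>A \<inter> B\<close> spans none, and then \<open>(A, B)\<close> is not a modular pair. If
  both span the same line, adjoining that line to \<open>A \<inter> B\<close> shows this. Otherwise neither has rank 3,
  so they lie in different lines and meet in rank 0, whereas \<open>r A + r B = 4\<close> and \<open>r (A \<union> B) \<le> 3\<close>.
\<close>

lemma meet_rk_submodular:
  assumes sk: "skew_lines L L'" and AB: "A \<subseteq> S" "B \<subseteq> S"
  shows "meet_rk L L' (A \<union> B) + meet_rk L L' (A \<inter> B) \<le> meet_rk L L' A + meet_rk L L' B"
proof -
  note sub = skew_lines_subset[OF sk]
  let ?p = "meet_rk L L'" and ?on = "\<lambda>A. spans A L \<or> spans A L'"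
  have sm: "r (A \<union> B) + r (A \<inter> B) \<le> r A + r B"
    using rk_submodular AB by blast
  have up: "?on (A \<union> B)" if "?on A \<or> ?on B"
    using that spans_mono[of A _ "A \<union> B"] spans_mono[of B _ "A \<union> B"] AB sub by blast
  show ?thesis
  proof (cases "?on A \<and> ?on B \<and> \<not> ?on (A \<inter> B)")
    case False
    then show ?thesis using sm up by (auto simp: meet_rk_def)
  next
    case True
    have "r (A \<union> B) + r (A \<inter> B) < r A + r B"
    proof -
      have same: ?thesis if Z: "Z \<subseteq> S" "spans A Z" "spans B Z" "\<not> spans (A \<inter> B) Z" for Z
      proof -
        have "r (A \<union> B) + r ((A \<inter> B) \<union> Z) \<le> r (A \<union> Z) + r (B \<union> Z)"
          using AB Z by (intro r_submodular_le) auto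
        moreover have "r (A \<inter> B) \<le> r ((A \<inter> B) \<union> Z)"
          using AB Z by (intro rk_mono) auto
        ultimately show ?thesis using Z by (auto simp: spans_def)
      qed
      have diff: ?thesis
        if Z: "skew_lines Z Z'" "spans A Z" "spans B Z'" "\<not> spans A Z'" "\<not> spans B Z" for Z Z'
      proof -
        note subZ = skew_lines_subset[OF Z(1)]
        have 2: "r Z = 2" "r Z' = 2" "flat Z" "flat Z'" "r (Z \<inter> Z') = 0"
          using Z(1) by (auto simp: skew_lines_def)
        have lt: "r A < 3" if "\<not> spans A Y" "A \<subseteq> S" "Y \<subseteq> S" for A Y
        proof -
          have "r A \<le> r (A \<union> Y)" "r (A \<union> Y) \<le> 3"
            using that by (auto intro!: rk_mono r_le_3)
          then show ?thesis using that by (auto simp: spans_def)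
        qed
        have rA: "r A = 2"
          using lt[OF Z(4) AB(1) subZ(2)] spans_line_rank[OF Z(2) AB(1) subZ(1) 2(1)] by simp
        have rB: "r B = 2"
          using lt[OF Z(5) AB(2) subZ(1)] spans_line_rank[OF Z(3) AB(2) subZ(2) 2(2)] by simp
        have "A \<inter> B \<subseteq> Z \<inter> Z'"
          using spans_line_subset[OF Z(2) AB(1) 2(3,1) rA]
            spans_line_subset[OF Z(3) AB(2) 2(4,2) rB] by blast
        then have "r (A \<inter> B) = 0"
          using rk_mono[of "A \<inter> B" "Z \<inter> Z'"] 2 subZ by auto
        moreover have "r (A \<union> B) \<le> 3" using AB by (intro r_le_3) auto
        ultimately show ?thesis using rA rB by simp
      qed
      show ?thesis
        using True same[of L] same[of L'] diff[of L L'] diff[of L' L] sk sub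
        by (auto simp: skew_lines_commute)
    qed
    then show ?thesis using True up by (auto simp: meet_rk_def)
  qed
qed

text \<open>
  The inequality that a genuine common point of \<open>L\<close> and \<open>L'\<close> would give by submodularity of
  \<open>C \<union> L\<close> and \<open>C \<union> L'\<close>. It is what makes the ideal point a substitute for the missing
  intersection of the two lines.
\<close>

lemma meet_rk_le:
  assumes sk: "skew_lines L L'" and C: "C \<subseteq> S"
  shows "meet_rk L L' C + 3 \<le> r (C \<union> L) + r (C \<union> L')"
proof -
  note sub = skew_lines_subset[OF sk]
  have L: "r L = 2" "r L' = 2" "flat L" "flat L'" "r (L \<inter> L') = 0"
    using sk by (auto simp: skew_lines_def)
  have sm: "3 + r C \<le> r (C \<union> L) + r (C \<union> L')"
    using r_submodular_le[of "C \<union> L" "C \<union> L'" C "L \<union> L'"] skew_lines_span[OF sk] C sub by auto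
  show ?thesis
  proof (cases "spans C L \<or> spans C L'")
    case True
    then show ?thesis using sm by (auto simp: meet_rk_def)
  next
    case False
    have gt: "r C < r (C \<union> L)" "r C < r (C \<union> L')"
      using False rk_mono[of C "C \<union> L"] rk_mono[of C "C \<union> L'"] C sub
      by (auto simp: spans_def less_le)
    have ge: "2 \<le> r (C \<union> L)" "2 \<le> r (C \<union> L')"
      using rk_mono[of L "C \<union> L"] rk_mono[of L' "C \<union> L'"] C sub L by auto
    have "\<not> (r C = 1 \<and> r (C \<union> L) = 2 \<and> r (C \<union> L') = 2)"
    proof
      assume *: "r C = 1 \<and> r (C \<union> L) = 2 \<and> r (C \<union> L') = 2"
      have "C \<subseteq> L" "C \<subseteq> L'"
        using flatD[OF L(3) C] flatD[OF L(4) C] * L by (simp_all add: Un_commute)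
      then show False using rk_mono[of C "L \<inter> L'"] sub L * by auto
    qed
    then show ?thesis using gt ge sm False by (auto simp: meet_rk_def)
  qed
qed

text \<open>
  For incomparable flats, the join has larger rank than either of them, so both ranks are at most 2;
  a point and any incomparable flat, and two lines with a common point, then form modular pairs.
\<close>

lemma flats_modular_or_skew:
  assumes F: "flat F" and G: "flat G"
  shows "r F + r G = r (F \<union> G) + r (F \<inter> G) \<or> skew_lines F G"
proof (cases "F \<subseteq> G \<or> G \<subseteq> F")
  case True
  then show ?thesis by (auto simp: Un_absorb1 Un_absorb2 Int_absorb1 Int_absorb2)
next
  case False
  have sub: "F \<subseteq> S" "G \<subseteq> S" using F G by (auto simp: flat_subset)
  have "r F < r (F \<union> G)" "r G < r (F \<union> G)"
    using flatD[OF F sub(2)] flatD[OF G sub(1)] False by (force simp: Un_commute)+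
  moreover have "r (F \<union> G) \<le> 3" using sub by (intro r_le_3) auto
  moreover have "r (F \<union> G) + r (F \<inter> G) \<le> r F + r G"
    using sub rk_submodular by blast
  ultimately show ?thesis using F G unfolding skew_lines_def by linarith
qed

text \<open>
  The rank of \<open>A\<close> together with two independent points spanning a line whose elements in \<open>S\<close> are
  those of \<open>G\<close>. For a rank-2 flat \<open>G\<close> this is \<open>r (A \<union> G)\<close>; the lines joining ideal points give rise
  to sets \<open>G\<close> of smaller rank.
\<close>
definition line_rk :: "'a set \<Rightarrow> 'a set \<Rightarrow> nat" where
  "line_rk G A = (if A \<subseteq> G then 2 else 3)"

text \<open>
  The line through an ideal point and a genuine point \<open>G\<close>. It is \<open>L\<close> or \<open>L'\<close> if \<open>G\<close> lies on one of
  them. Otherwise it is a new line, on which \<open>G\<close> is the only genuine point.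
\<close>

lemma meet_point_join:
  assumes sk: "skew_lines L L'" and G: "flat G" "r G = 1"
  obtains J where "J \<subseteq> S" "r J \<le> 2"
    "\<And>C. C \<subseteq> S \<Longrightarrow> line_rk J C \<le> meet_rk L L' (C \<union> G)"
proof -
  note sub = skew_lines_subset[OF sk] flat_subset[OF G(1)]
  have L: "r L = 2" "r L' = 2" "flat L" "flat L'" "r (L \<inter> L') = 0"
    using sk by (auto simp: skew_lines_def)
  have not_both: "\<not> (G \<subseteq> L \<and> G \<subseteq> L')"
    using rk_mono[of G "L \<inter> L'"] sub L G by auto
  define J where "J = (if G \<subseteq> L then L else if G \<subseteq> L' then L' else G)"
  have GJ: "G \<subseteq> J" by (simp add: J_def)
  have "line_rk J C \<le> meet_rk L L' (C \<union> G)" if C: "C \<subseteq> S" for C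
  proof -
    let ?D = "C \<union> G"
    have D: "?D \<subseteq> S" using C sub by auto
    have rD: "1 \<le> r ?D" using rk_mono[of G ?D] D G by auto
    have on: "?D \<subseteq> Z" if "spans ?D Z" "r ?D \<le> 2" "Z = L \<or> Z = L'" for Z
    proof -
      have Z: "flat Z" "r Z = 2" "Z \<subseteq> S" using that L sub by auto
      then have "r ?D = 2" using spans_line_rank[OF that(1) D] that by auto
      then show ?thesis using spans_line_subset[OF that(1) D] Z by auto
    qed
    show ?thesis
    proof (cases "3 \<le> meet_rk L L' ?D")
      case True
      then show ?thesis by (simp add: line_rk_def)
    next
      case False
      have "C \<subseteq> J \<and> 2 \<le> meet_rk L L' ?D"
      proof (cases "spans ?D L \<or> spans ?D L'")
        case True
        then have "r ?D \<le> 2" using False by (auto simp: meet_rk_def)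
        then have "(?D \<subseteq> L \<or> ?D \<subseteq> L')"
          using on True by blast
        moreover have "2 \<le> r ?D"
          using True spans_line_rank[OF _ D] sub L by blast
        ultimately show ?thesis using not_both True by (auto simp: J_def meet_rk_def)
      next
        case notspan: False
        then have "r ?D = 1" using False rD by (auto simp: meet_rk_def)
        then have "C \<subseteq> G" using flatD[OF G(1) C] G(2) by (simp add: Un_commute)
        then show ?thesis using GJ notspan \<open>r ?D = 1\<close> by (auto simp: meet_rk_def)
      qed
      then show ?thesis by (simp add: line_rk_def)
    qed
  qed
  moreover have "J \<subseteq> S" "r J \<le> 2" using sub L G by (auto simp: J_def)
  ultimately show thesis using that by blast
qed

text \<open>
  The line through two different ideal points is the line used by both of them, if there is one:
  two pairs that share both lines would be equal. Otherwise it is a new line that carries no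
  genuine point, only loops.
\<close>

lemma meet_meet_join:
  assumes sk: "skew_lines L L'" and sk': "skew_lines K K'"
    and ne: "{L, L'} \<noteq> {K, K'}"
  obtains J where "J \<subseteq> S" "r J \<le> 2"
    "\<And>A B. A \<subseteq> S \<Longrightarrow> B \<subseteq> S \<Longrightarrow>
      line_rk J (A \<union> B) + r (A \<inter> B) \<le> meet_rk L L' A + meet_rk K K' B"
proof -
  note sub = skew_lines_subset[OF sk] skew_lines_subset[OF sk']
  have L: "flat Z \<and> r Z = 2 \<and> Z \<subseteq> S" if "Z \<in> {L, L', K, K'}" for Z
    using that sk sk' sub by (auto simp: skew_lines_def)
  have distinct: "L \<noteq> L'" "K \<noteq> K'"
    using sk sk' by (auto simp: skew_lines_def)
  obtain Z0 where Z0: "flat Z0" "r Z0 = 0" using flat_hull[of "{}"] by auto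
  obtain J where J: "flat J" "r J \<le> 2" "\<And>Z. Z \<in> {L, L'} \<inter> {K, K'} \<Longrightarrow> Z = J"
  proof (cases "{L, L'} \<inter> {K, K'} = {}")
    case True
    then show thesis using Z0 that by auto
  next
    case False
    then obtain Z where Z: "Z \<in> {L, L'}" "Z \<in> {K, K'}" by blast
    have "Y = Z" if Y: "Y \<in> {L, L'}" "Y \<in> {K, K'}" for Y
    proof (rule ccontr)
      assume "Y \<noteq> Z"
      then have "{L, L'} = {Y, Z}" "{K, K'} = {Y, Z}"
        using Y Z by (elim insertE emptyE; simp add: insert_commute)+
      then show False using ne by simp
    qed
    then have "Y = Z" if "Y \<in> {L, L'} \<inter> {K, K'}" for Y
      using that by blast
    moreover have "Z \<in> {L, L', K, K'}" using Z(1) by blast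
    then have "flat Z" "r Z \<le> 2" using L by simp_all
    ultimately show thesis by (intro that)
  qed
  have JS: "J \<subseteq> S" using J flat_subset by blast
  have loops: "C \<subseteq> J" if "C \<subseteq> S" "r C = 0" for C
  proof -
    have "r (J \<union> C) + r {} \<le> r J + r C"
      using that JS by (intro r_submodular_le) auto
    then show ?thesis using that by (intro flatD[OF J(1)]) auto
  qed
  have key: "line_rk J C \<le> meet_rk Z Z' C + 1"
    if C: "C \<subseteq> S" and Z: "skew_lines Z Z'" for C Z Z'
  proof -
    have "2 \<le> meet_rk Z Z' C \<or> (1 \<le> meet_rk Z Z' C \<and> r C = 0)"
      using spans_line_rank[of C] C Z skew_lines_subset[OF Z]
      by (auto simp: meet_rk_def skew_lines_def)
    then show ?thesis using loops[OF C] by (auto simp: line_rk_def)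
  qed
  have "line_rk J (A \<union> B) + r (A \<inter> B) \<le> meet_rk L L' A + meet_rk K K' B"
    if AB: "A \<subseteq> S" "B \<subseteq> S" for A B
  proof (cases "(spans A L \<or> spans A L') \<and> (spans B K \<or> spans B K')")
    case False
    then consider "\<not> (spans B K \<or> spans B K')" | "\<not> (spans A L \<or> spans A L')" by blast
    then show ?thesis
    proof cases
      case 1
      then have "meet_rk K K' B = r B + 1" by (simp add: meet_rk_def)
      then show ?thesis
        using meet_rk_quotient[OF sk AB] key[of "A \<union> B", OF _ sk] AB by simp
    next
      case 2
      then have "meet_rk L L' A = r A + 1" by (simp add: meet_rk_def)
      then show ?thesis
        using meet_rk_quotient[OF sk' AB(2,1)] key[of "A \<union> B", OF _ sk'] AB
        by (simp add: Un_commute Int_commute)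
    qed
  next
    case True
    then obtain Y Z where Y: "Y \<in> {L, L'}" "spans A Y" and Z: "Z \<in> {K, K'}" "spans B Z"
      by blast
    have "Y \<subseteq> S" "Z \<subseteq> S" "r Y = 2" "r Z = 2" "flat Y" "flat Z" using Y Z L by auto
    note YZ = this
    have ge: "2 \<le> r A" "2 \<le> r B"
      using spans_line_rank[OF Y(2) AB(1)] spans_line_rank[OF Z(2) AB(2)] YZ by auto
    have le: "r (A \<inter> B) \<le> r A" "r (A \<inter> B) \<le> r B" "r A \<le> 3" "r B \<le> 3"
      using AB by (auto intro!: rk_mono r_le_3)
    have "line_rk J (A \<union> B) + r (A \<inter> B) \<le> r A + r B"
    \<comment> \<open>All ranks are 2 or 3 and \<open>line_rk\<close> is at most 3, so the claim can only fail if \<open>A\<close>, \<open>B\<close> and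
      \<open>A \<inter> B\<close> all have rank 2; then both ideal points use the line spanned by \<open>A \<inter> B\<close>.\<close>
    proof (cases "r A = 2 \<and> r B = 2 \<and> r (A \<inter> B) = 2")
      case False
      moreover have "line_rk J (A \<union> B) \<le> 3" by (simp add: line_rk_def)
      ultimately show ?thesis using ge le by linarith
    next
      case True
      have in_line: "A \<subseteq> Y" "B \<subseteq> Z"
        using spans_line_subset[OF Y(2) AB(1)] spans_line_subset[OF Z(2) AB(2)] YZ True by auto
      have "r (Y \<union> Z) + r (A \<inter> B) \<le> r Y + r Z"
        using YZ in_line by (intro r_submodular_le) auto
      then have "r (Y \<union> Z) \<le> 2" using True YZ by simp
      then have "Y = Z"
        using flatD[of Y Z] flatD[of Z Y] YZ by (auto simp: Un_commute)
      then have "Y = J" using J(3) Y Z by blast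
      then have "A \<union> B \<subseteq> J" using in_line \<open>Y = Z\<close> by blast
      then show ?thesis using True by (simp add: line_rk_def)
    qed
    moreover have "meet_rk L L' A = r A" "meet_rk K K' B = r B"
      using True by (auto simp: meet_rk_def)
    ultimately show ?thesis by simp
  qed
  with J JS that show thesis by blast
qed

end

section \<open>The minimum of the bounds\<close>

locale rank3_columns = rank3_matroid M for M :: "'a ranked_set" +
  fixes T :: "'b set" and k :: nat
  assumes finite_T: "finite T"
begin

text \<open>
  The bound on the rank of \<open>X\<close> that comes from adjoining to \<open>M\<close> a flat \<open>F\<close> of some extension, where
  \<open>\<rho> A\<close> is the rank of \<open>A \<union> F\<close>, so that \<open>\<rho> {}\<close> is the rank of \<open>F\<close>.
\<close>
definition cost :: "('a set \<Rightarrow> nat) \<Rightarrow> ('a \<times> 'b) set \<Rightarrow> nat" where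
  "cost \<rho> X = k * \<rho> {} + (\<Sum>t\<in>T. \<rho> (slice X t) - \<rho> {})"

text \<open>
  Arbitrary subsets of \<open>S\<close> are admitted, not only flats, so that joins can be formed as unions.
\<close>
inductive_set gauges :: "('a set \<Rightarrow> nat) set" where
  subset_gauge: "F \<subseteq> S \<Longrightarrow> (\<lambda>A. r (A \<union> F)) \<in> gauges"
| meet_gauge: "skew_lines L L' \<Longrightarrow> meet_rk L L' \<in> gauges"

definition free_rk :: "('a \<times> 'b) set \<Rightarrow> nat" where
  "free_rk X = Inf ((\<lambda>\<rho>. cost \<rho> X) ` gauges)"

lemma gauges_mono: "\<rho> \<in> gauges \<Longrightarrow> mono_on (Pow S) \<rho>"
  by (auto elim!: gauges.cases intro!: mono_onI rk_mono meet_rk_mono)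

lemma gauges_ge: "\<rho> \<in> gauges \<Longrightarrow> A \<subseteq> S \<Longrightarrow> r A \<le> \<rho> A"
  by (auto elim!: gauges.cases intro!: rk_mono r_le_meet_rk)

lemma r_gauge: "r \<in> gauges"
  using subset_gauge[of "{}"] by simp

lemma free_rk_le: "\<rho> \<in> gauges \<Longrightarrow> free_rk X \<le> cost \<rho> X"
  unfolding free_rk_def by (intro cInf_lower) auto

lemma free_rk_attained:
  obtains \<rho> where "\<rho> \<in> gauges" "free_rk X = cost \<rho> X"
proof -
  have "free_rk X \<in> (\<lambda>\<rho>. cost \<rho> X) ` gauges"
    unfolding free_rk_def using r_gauge by (intro Inf_nat_def1) auto
  then show thesis using that by auto
qed

lemma cost_le:
  assumes "X \<subseteq> S \<times> T" "Y \<subseteq> S \<times> T" "\<rho> {} = \<sigma> {}"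
    and "\<And>t. t \<in> T \<Longrightarrow> \<rho> (slice X t) \<le> \<sigma> (slice Y t)"
  shows "cost \<rho> X \<le> cost \<sigma> Y"
  unfolding cost_def using assms(3,4) by (auto intro!: sum_mono diff_le_mono)

text \<open>
  Let \<open>m\<close> be the number of slices not contained in \<open>G\<close>, so that the cost of the line is \<open>2 * k + m\<close>.
  If \<open>m > k\<close>, the bound \<open>3 * k\<close> of the whole ground set is better. If \<open>m \<le> k\<close>, the bound of \<open>G\<close>
  itself is at most \<open>k * r G + m * (3 - r G)\<close>, which exceeds \<open>2 * k + m\<close> by
  \<open>(m - k) * (2 - r G) \<le> 0\<close>.
\<close>

lemma free_rk_le_line:
  assumes X: "X \<subseteq> S \<times> T" and G: "G \<subseteq> S" "r G \<le> 2"
  shows "free_rk X \<le> cost (line_rk G) X"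
proof -
  define m where "m = card {t \<in> T. \<not> slice X t \<subseteq> G}"
  have count: "(\<Sum>t\<in>T. if slice X t \<subseteq> G then 0 else c) = m * c" for c :: nat
  proof -
    have "(\<Sum>t\<in>T. if slice X t \<subseteq> G then 0 else c) = (\<Sum>t\<in>{t \<in> T. \<not> slice X t \<subseteq> G}. c)"
      using finite_T by (intro sum.mono_neutral_cong_right) auto
    then show ?thesis by (simp add: m_def)
  qed
  have "cost (line_rk G) X = 2 * k + m"
    using count[of 1] unfolding cost_def line_rk_def
    by (simp add: if_distrib[of "\<lambda>x. x - 2"] cong: if_cong)
  moreover have "free_rk X \<le> 2 * k + m"
  proof (cases "m \<le> k")
    case True
    have "r (slice X t \<union> G) - r G \<le> (if slice X t \<subseteq> G then 0 else 3 - r G)" for t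
      using slice_subset[OF X, of t] G r_le_3[of "slice X t \<union> G"]
      by (auto simp: Un_absorb1)
    then have "cost (\<lambda>A. r (A \<union> G)) X \<le> k * r G + m * (3 - r G)"
      unfolding cost_def count[symmetric] by (auto intro!: sum_mono)
    also have "\<dots> \<le> 2 * k + m"
    proof -
      have "m * (2 - r G) \<le> k * (2 - r G)" using True by simp
      moreover have "r G = 0 \<or> r G = 1 \<or> r G = 2" using G by linarith
      ultimately show ?thesis by auto
    qed
    finally show ?thesis
      using free_rk_le[OF subset_gauge[OF G(1)], of X] by simp
  next
    case False
    have "cost (\<lambda>A. r (A \<union> S)) X = 3 * k"
      using slice_subset[OF X] by (simp add: cost_def Un_absorb1 r_ground)
    then show ?thesis
      using free_rk_le[OF subset_gauge[of S], of X] False by simp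
  qed
  ultimately show ?thesis by simp
qed

text \<open>
  An uncrossing inequality between functions on subsets of \<open>S\<close> lifts to the costs slice by slice.
  The constant \<open>\<rho> {}\<close> enters the cost with coefficient \<open>k - card T\<close>, so the constants cancel if their
  sums agree; for flats, this says that they form a modular pair.
\<close>

lemma cost_uncross:
  assumes "X \<subseteq> S \<times> T" "Y \<subseteq> S \<times> T"
    and "mono_on (Pow S) \<alpha>" "mono_on (Pow S) \<beta>"
    and "\<alpha> {} + \<beta> {} = \<rho> {} + \<sigma> {}"
    and "\<And>A B. A \<subseteq> S \<Longrightarrow> B \<subseteq> S \<Longrightarrow> \<alpha> (A \<union> B) + \<beta> (A \<inter> B) \<le> \<rho> A + \<sigma> B"
  shows "cost \<alpha> (X \<union> Y) + cost \<beta> (X \<inter> Y) \<le> cost \<rho> X + cost \<sigma> Y"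
proof -
  have "(\<alpha> (slice (X \<union> Y) t) - \<alpha> {}) + (\<beta> (slice (X \<inter> Y) t) - \<beta> {})
      \<le> (\<rho> (slice X t) - \<rho> {}) + (\<sigma> (slice Y t) - \<sigma> {})" for t
  proof -
    have s: "slice X t \<subseteq> S" "slice Y t \<subseteq> S"
      using slice_subset[OF assms(1)] slice_subset[OF assms(2)] by auto
    have "\<alpha> {} \<le> \<alpha> (slice (X \<union> Y) t)" "\<beta> {} \<le> \<beta> (slice (X \<inter> Y) t)"
      using s by (auto intro!: mono_onD[OF assms(3)] mono_onD[OF assms(4)])
    moreover have "\<alpha> (slice (X \<union> Y) t) + \<beta> (slice (X \<inter> Y) t) \<le> \<rho> (slice X t) + \<sigma> (slice Y t)"
      using assms(6)[OF s] by simp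
    ultimately show ?thesis using assms(5) by linarith
  qed
  then have "(\<Sum>t\<in>T. (\<alpha> (slice (X \<union> Y) t) - \<alpha> {}) + (\<beta> (slice (X \<inter> Y) t) - \<beta> {}))
      \<le> (\<Sum>t\<in>T. (\<rho> (slice X t) - \<rho> {}) + (\<sigma> (slice Y t) - \<sigma> {}))"
    by (intro sum_mono)
  moreover have "k * \<alpha> {} + k * \<beta> {} = k * \<rho> {} + k * \<sigma> {}"
    using assms(5) by (metis distrib_left)
  ultimately show ?thesis by (simp add: cost_def sum.distrib)
qed

lemma free_rk_uncross_gauges:
  assumes "X \<subseteq> S \<times> T" "Y \<subseteq> S \<times> T" "\<alpha> \<in> gauges" "\<beta> \<in> gauges"
    and "\<alpha> {} + \<beta> {} = \<rho> {} + \<sigma> {}"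
    and "\<And>A B. A \<subseteq> S \<Longrightarrow> B \<subseteq> S \<Longrightarrow> \<alpha> (A \<union> B) + \<beta> (A \<inter> B) \<le> \<rho> A + \<sigma> B"
  shows "free_rk (X \<union> Y) + free_rk (X \<inter> Y) \<le> cost \<rho> X + cost \<sigma> Y"
  using cost_uncross[of X Y \<alpha> \<beta> \<rho> \<sigma>] assms gauges_mono
    free_rk_le[of \<alpha> "X \<union> Y"] free_rk_le[of \<beta> "X \<inter> Y"] by (meson add_mono le_trans)

lemma free_rk_uncross_line:
  assumes XY: "X \<subseteq> S \<times> T" "Y \<subseteq> S \<times> T" and J: "J \<subseteq> S" "r J \<le> 2"
    and "\<rho> {} + \<sigma> {} = 2"
    and "\<And>A B. A \<subseteq> S \<Longrightarrow> B \<subseteq> S \<Longrightarrow> line_rk J (A \<union> B) + r (A \<inter> B) \<le> \<rho> A + \<sigma> B"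
  shows "free_rk (X \<union> Y) + free_rk (X \<inter> Y) \<le> cost \<rho> X + cost \<sigma> Y"
proof -
  have "mono_on (Pow S) (line_rk J)" by (intro mono_onI) (simp add: line_rk_def; blast)
  moreover have "line_rk J {} = 2" by (simp add: line_rk_def)
  ultimately have "cost (line_rk J) (X \<union> Y) + cost r (X \<inter> Y) \<le> cost \<rho> X + cost \<sigma> Y"
    using assms gauges_mono[OF r_gauge] by (intro cost_uncross) auto
  moreover have "free_rk (X \<union> Y) \<le> cost (line_rk J) (X \<union> Y)"
    using XY J by (intro free_rk_le_line) auto
  ultimately show ?thesis using free_rk_le[OF r_gauge, of "X \<inter> Y"] by simp
qed

lemma uncross_flats:
  assumes XY: "X \<subseteq> S \<times> T" "Y \<subseteq> S \<times> T" and F: "flat F" and G: "flat G"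
  shows "free_rk (X \<union> Y) + free_rk (X \<inter> Y) \<le> cost (\<lambda>A. r (A \<union> F)) X + cost (\<lambda>A. r (A \<union> G)) Y"
proof -
  have sub: "F \<subseteq> S" "G \<subseteq> S" using F G by (auto simp: flat_subset)
  consider "r F + r G = r (F \<union> G) + r (F \<inter> G)" | "skew_lines F G"
    using flats_modular_or_skew[OF F G] by blast
  then show ?thesis
  proof cases
    case 1
    have "r (A \<union> B \<union> (F \<union> G)) + r (A \<inter> B \<union> F \<inter> G) \<le> r (A \<union> F) + r (B \<union> G)"
      if "A \<subseteq> S" "B \<subseteq> S" for A B
      using that sub by (intro r_submodular_le) auto
    moreover have "F \<union> G \<subseteq> S" "F \<inter> G \<subseteq> S" using sub by auto
    note gauges = this[THEN subset_gauge]
    ultimately show ?thesis using 1 by (intro free_rk_uncross_gauges[OF XY gauges]) auto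
  next
    case 2
    have "r (A \<union> B \<union> S) + meet_rk F G (A \<inter> B) \<le> r (A \<union> F) + r (B \<union> G)"
      if AB: "A \<subseteq> S" "B \<subseteq> S" for A B
    proof -
      have "r (A \<inter> B \<union> F) \<le> r (A \<union> F)" "r (A \<inter> B \<union> G) \<le> r (B \<union> G)"
        using AB sub by (auto intro!: rk_mono)
      moreover have "A \<union> B \<union> S = S" "A \<inter> B \<subseteq> S" using AB by auto
      ultimately show ?thesis using meet_rk_le[OF 2, of "A \<inter> B"] r_ground by simp
    qed
    moreover have "r ({} \<union> S) + meet_rk F G {} = r ({} \<union> F) + r ({} \<union> G)"
      using 2 meet_rk_empty[OF 2] r_ground by (simp add: skew_lines_def)
    ultimately show ?thesis
      by (intro free_rk_uncross_gauges[OF XY subset_gauge[OF order_refl] meet_gauge[OF 2]])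
  qed
qed

text \<open>
  The ideal point either lies on the flat \<open>G\<close>, so that the two are comparable, or it does not. In
  the latter case their meet has rank 0 and their join is the ideal point itself, a
  line or the whole plane, according to the rank of \<open>G\<close>.
\<close>

lemma uncross_meet_flat:
  assumes XY: "X \<subseteq> S \<times> T" "Y \<subseteq> S \<times> T" and sk: "skew_lines L L'" and G: "flat G"
  shows "free_rk (X \<union> Y) + free_rk (X \<inter> Y) \<le> cost (meet_rk L L') X + cost (\<lambda>A. r (A \<union> G)) Y"
proof -
  note sub = skew_lines_subset[OF sk] flat_subset[OF G]
  let ?p = "meet_rk L L'"
  have p: "?p \<in> gauges" "?p {} = 1" using sk by (auto intro: meet_gauge)
  have quot: "?p (A \<union> B \<union> G) + r (A \<inter> B) \<le> ?p A + r (B \<union> G)"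
    if AB: "A \<subseteq> S" "B \<subseteq> S" for A B
  proof -
    have "r (A \<inter> B) \<le> r (A \<inter> (B \<union> G))" using AB by (intro rk_mono) auto
    then show ?thesis
      using meet_rk_quotient[OF sk AB(1), of "B \<union> G"] AB sub by (simp add: Un_assoc)
  qed
  show ?thesis
  proof (cases "spans G L \<or> spans G L'")
    case True
    have "r (A \<union> B \<union> G) + ?p (A \<inter> B) \<le> ?p A + r (B \<union> G)"
      if AB: "A \<subseteq> S" "B \<subseteq> S" for A B
    proof -
      have on: "?p D = r D" if "G \<subseteq> D" "D \<subseteq> S" for D
        using True spans_mono[of G _ D] that sub by (auto simp: meet_rk_def)
      have "?p (A \<inter> B) \<le> ?p (A \<inter> (B \<union> G))"
        using AB by (intro meet_rk_mono[OF sk]) auto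
      moreover have "G \<subseteq> A \<union> (B \<union> G)" by blast
      ultimately show ?thesis
        using meet_rk_submodular[OF sk AB(1), of "B \<union> G"] on[of "B \<union> G"]
          on[of "A \<union> (B \<union> G)"] AB sub by (simp add: Un_assoc)
    qed
    then show ?thesis
      using p by (intro free_rk_uncross_gauges[OF XY subset_gauge[OF sub(3)] p(1)]) auto
  next
    case False
    then have pG: "?p G = r G + 1" by (simp add: meet_rk_def)
    have "r G \<noteq> 3"
      using False sub rk_mono[of G "G \<union> L"] r_le_3[of "G \<union> L"] by (auto simp: spans_def)
    then consider "r G = 0" | "r G = 1" | "r G = 2" using r_le_3[of G] sub by linarith
    then show ?thesis
    proof cases
      case 1
      have "?p (A \<union> B) + r (A \<inter> B) \<le> ?p A + r (B \<union> G)" if AB: "A \<subseteq> S" "B \<subseteq> S" for A B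
        using quot[OF AB] meet_rk_mono[OF sk, of "A \<union> B" "A \<union> B \<union> G"] AB sub by auto
      then show ?thesis
        using p 1 by (intro free_rk_uncross_gauges[OF XY p(1) r_gauge]) auto
    next
      case 2
      obtain J where J: "J \<subseteq> S" "r J \<le> 2" "\<And>C. C \<subseteq> S \<Longrightarrow> line_rk J C \<le> ?p (C \<union> G)"
        using meet_point_join[OF sk G 2] by blast
      have "line_rk J (A \<union> B) + r (A \<inter> B) \<le> ?p A + r (B \<union> G)" if AB: "A \<subseteq> S" "B \<subseteq> S" for A B
        using quot[OF AB] J(3)[of "A \<union> B"] AB by auto
      then show ?thesis
        using XY p 2 J by (intro free_rk_uncross_line) auto
    next
      case 3
      have "r (A \<union> B \<union> S) + r (A \<inter> B) \<le> ?p A + r (B \<union> G)" if AB: "A \<subseteq> S" "B \<subseteq> S" for A B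
      proof -
        have "A \<union> B \<union> S = S" using AB by auto
        moreover have "?p G \<le> ?p (A \<union> B \<union> G)"
          using AB sub by (intro meet_rk_mono[OF sk]) auto
        ultimately show ?thesis using quot[OF AB] pG 3 r_ground by simp
      qed
      then show ?thesis
        using p 3 r_ground
        by (intro free_rk_uncross_gauges[OF XY subset_gauge[OF order_refl] r_gauge]) auto
    qed
  qed
qed

lemma uncross_meets:
  assumes XY: "X \<subseteq> S \<times> T" "Y \<subseteq> S \<times> T" and sk: "skew_lines L L'" "skew_lines K K'"
  shows "free_rk (X \<union> Y) + free_rk (X \<inter> Y) \<le> cost (meet_rk L L') X + cost (meet_rk K K') Y"
proof (cases "{L, L'} = {K, K'}")
  case True
  then have "meet_rk K K' = meet_rk L L'"
    by (auto simp: doubleton_eq_iff meet_rk_commute)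
  then show ?thesis
    using meet_rk_submodular[OF sk(1)]
    by (intro free_rk_uncross_gauges[OF XY meet_gauge[OF sk(1)] meet_gauge[OF sk(1)]]) auto
next
  case False
  obtain J where "J \<subseteq> S" "r J \<le> 2"
    "\<And>A B. A \<subseteq> S \<Longrightarrow> B \<subseteq> S \<Longrightarrow>
      line_rk J (A \<union> B) + r (A \<inter> B) \<le> meet_rk L L' A + meet_rk K K' B"
    using meet_meet_join[OF sk False] by blast
  then show ?thesis
    using XY sk by (intro free_rk_uncross_line) auto
qed

text \<open>
  Replacing a set by its closure does not change its bound, so only flats need to be uncrossed.
\<close>

lemma free_rk_attained_cases [consumes 1, case_names flat meet]:
  assumes X: "X \<subseteq> S \<times> T"
  obtains F where "flat F" "free_rk X = cost (\<lambda>A. r (A \<union> F)) X"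
    | L L' where "skew_lines L L'" "free_rk X = cost (meet_rk L L') X"
proof -
  obtain \<rho> where \<rho>: "\<rho> \<in> gauges" "free_rk X = cost \<rho> X" by (rule free_rk_attained)
  from \<rho>(1) show thesis
  proof cases
    case (subset_gauge E)
    obtain F where F: "flat F" "E \<subseteq> F" "r F = r E"
      using flat_hull subset_gauge by blast
    have "r (slice X t \<union> F) = r (slice X t \<union> E)" for t
      using F slice_subset[OF X] by (intro r_Un_cong) (auto simp: flat_subset)
    then have "cost (\<lambda>A. r (A \<union> F)) X = cost \<rho> X"
      using F subset_gauge by (simp add: cost_def)
    then show thesis using that(1) F \<rho> by simp
  next
    case (meet_gauge L L')
    then show thesis using that(2) \<rho> by simp
  qed
qed

lemma free_rk_submodular:
  assumes XY: "X \<subseteq> S \<times> T" "Y \<subseteq> S \<times> T"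
  shows "free_rk (X \<union> Y) + free_rk (X \<inter> Y) \<le> free_rk X + free_rk Y"
using XY(1)
proof (cases rule: free_rk_attained_cases)
  case X: (flat F)
  show ?thesis using XY(2)
  proof (cases rule: free_rk_attained_cases)
    case (flat G)
    then show ?thesis using uncross_flats[OF XY X(1)] X by simp
  next
    case (meet K K')
    then show ?thesis using uncross_meet_flat[OF XY(2,1) meet(1) X(1)] X
      by (simp add: Un_commute Int_commute add.commute)
  qed
next
  case X: (meet L L')
  show ?thesis using XY(2)
  proof (cases rule: free_rk_attained_cases)
    case (flat G)
    then show ?thesis using uncross_meet_flat[OF XY X(1)] X by simp
  next
    case (meet K K')
    then show ?thesis using uncross_meets[OF XY X(1) meet(1)] X by simp
  qed
qed

text \<open>
  The bounds of \<open>{}\<close> and of \<open>A\<close> are \<open>card B * r A\<close> and \<open>k * r A\<close>. Conversely, the cost of any gauge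
  \<open>\<rho>\<close> splits \<open>\<rho> A \<ge> r A\<close> into two parts, one taken \<open>k\<close> times and the other \<open>card B\<close> times.
\<close>

lemma free_rk_product:
  assumes A: "A \<subseteq> S" and B: "B \<subseteq> T"
  shows "free_rk (A \<times> B) = r A * min (card B) k"
proof (rule antisym)
  have cost: "cost \<rho> (A \<times> B) = k * \<rho> {} + card B * (\<rho> A - \<rho> {})" for \<rho>
  proof -
    have "(\<Sum>t\<in>T. \<rho> (slice (A \<times> B) t) - \<rho> {}) = (\<Sum>t\<in>B. \<rho> A - \<rho> {})"
      using finite_T B by (intro sum.mono_neutral_cong_right) auto
    then show ?thesis by (simp add: cost_def)
  qed
  have "cost r (A \<times> B) = card B * r A" by (simp add: cost)
  moreover have "cost (\<lambda>C. r (C \<union> A)) (A \<times> B) = k * r A" by (simp add: cost)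
  ultimately show "free_rk (A \<times> B) \<le> r A * min (card B) k"
    using free_rk_le[OF r_gauge, of "A \<times> B"] free_rk_le[OF subset_gauge[OF A], of "A \<times> B"]
    by (simp add: min_def mult.commute)
  obtain \<rho> where \<rho>: "\<rho> \<in> gauges" "free_rk (A \<times> B) = cost \<rho> (A \<times> B)"
    by (rule free_rk_attained)
  let ?m = "min (card B) k"
  have "r A \<le> \<rho> A" using gauges_ge[OF \<rho>(1) A] .
  moreover have "\<rho> {} \<le> \<rho> A" using A by (intro mono_onD[OF gauges_mono[OF \<rho>(1)]]) auto
  ultimately have "r A * ?m \<le> ?m * (\<rho> {} + (\<rho> A - \<rho> {}))" by (simp add: mult.commute)
  also have "\<dots> \<le> k * \<rho> {} + card B * (\<rho> A - \<rho> {})"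
    unfolding distrib_left by (intro add_mono mult_le_mono1) auto
  finally show "r A * ?m \<le> free_rk (A \<times> B)" using \<rho>(2) cost by simp
qed

lemma free_rk_mono:
  assumes "X \<subseteq> Y" "Y \<subseteq> S \<times> T"
  shows "free_rk X \<le> free_rk Y"
proof -
  obtain \<rho> where \<rho>: "\<rho> \<in> gauges" "free_rk Y = cost \<rho> Y" by (rule free_rk_attained)
  have "cost \<rho> X \<le> cost \<rho> Y"
    using assms slice_mono[OF assms(1)] slice_subset[OF assms(2)] slice_subset[of X S T]
    by (intro cost_le mono_onD[OF gauges_mono[OF \<rho>(1)]]) auto
  then show ?thesis using free_rk_le[OF \<rho>(1), of X] \<rho>(2) by simp
qed

lemma free_rk_le_card:
  assumes "X \<subseteq> S \<times> T"
  shows "free_rk X \<le> card X"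
proof -
  have "free_rk X \<le> (\<Sum>t\<in>T. r (slice X t))"
    using free_rk_le[OF r_gauge, of X] by (simp add: cost_def)
  also have "\<dots> \<le> (\<Sum>t\<in>T. card (slice X t))"
    using slice_subset[OF assms] by (intro sum_mono rk_le_card) auto
  also have "\<dots> = card X"
    using card_eq_sum_slices[OF assms finite_ground finite_T] by simp
  finally show ?thesis .
qed

lemma matroid_free_rk: "matroid (S \<times> T, free_rk)"
  using finite_ground finite_T free_rk_le_card free_rk_mono free_rk_submodular
  by unfold_locales auto

end

section \<open>The bounds hold in every tensor product\<close>

text \<open>
  The factor \<open>min 1 k\<close> is the rank of a single element of \<open>U\<^sub>k\<^sub>,\<^sub>n\<close>, which is a loop if \<open>k = 0\<close>.
\<close>
locale rank3_columns_product = rank3_columns M T k + P: matroid P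
  for M :: "'a ranked_set" and T :: "'b set" and k :: nat and P :: "('a \<times> 'b) ranked_set" +
  assumes ground_P: "ground P = S \<times> T"
    and rk_full: "A \<subseteq> S \<Longrightarrow> rk P (A \<times> T) = r A * k"
    and rk_column: "A \<subseteq> S \<Longrightarrow> t \<in> T \<Longrightarrow> rk P (A \<times> {t}) = r A * min 1 k"
begin

text \<open>
  As \<open>Z\<close> contains \<open>F \<times> {t}\<close>, submodularity bounds the gain from column \<open>t\<close> by the gain
  over \<open>F \<times> {t}\<close>, and this is computed within the copy of \<open>M\<close> on \<open>S \<times> {t}\<close>.
\<close>

lemma add_columns:
  assumes "finite U" "U \<subseteq> T" and Z: "Z \<subseteq> S \<times> T" and F: "F \<subseteq> S" "F \<times> U \<subseteq> Z" and X: "X \<subseteq> S \<times> T"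
  shows "rk P (Z \<union> X \<inter> UNIV \<times> U) \<le> rk P Z + (\<Sum>t\<in>U. r (slice X t \<union> F) - r F)"
  using assms(1,2) F(2)
proof (induction U)
  case empty
  then show ?case by simp
next
  case (insert t U)
  let ?W = "Z \<union> X \<inter> UNIV \<times> U" and ?C = "(slice X t \<union> F) \<times> {t}"
  have t: "t \<in> T" and s: "slice X t \<union> F \<subseteq> S"
    using insert slice_subset[OF X] F by auto
  have sub: "?W \<subseteq> ground P" "?C \<subseteq> ground P"
    using Z X s t by (auto simp: ground_P)
  have "rk P (?W \<union> ?C) + rk P (?W \<inter> ?C) \<le> rk P ?W + rk P ?C"
    using sub P.rk_submodular by blast
  moreover have "rk P (F \<times> {t}) \<le> rk P (?W \<inter> ?C)"
    using insert.prems sub by (intro P.rk_mono) auto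
  moreover have "?W \<union> ?C = Z \<union> X \<inter> UNIV \<times> insert t U"
    using insert.prems by (auto simp: slice_def)
  ultimately have "rk P (Z \<union> X \<inter> UNIV \<times> insert t U) + r F * min 1 k
      \<le> rk P ?W + r (slice X t \<union> F) * min 1 k"
    using rk_column[OF F(1) t] rk_column[OF s t] by simp
  moreover have "r (slice X t \<union> F) * min 1 k \<le> r F * min 1 k + (r (slice X t \<union> F) - r F)"
    by (cases "k = 0") auto
  moreover have "rk P ?W \<le> rk P Z + (\<Sum>t\<in>U. r (slice X t \<union> F) - r F)"
    using insert.prems by (intro insert.IH) auto
  ultimately show ?case using insert.hyps by simp
qed

lemma rk_le_cost_subset:
  assumes X: "X \<subseteq> S \<times> T" and F: "F \<subseteq> S"
  shows "rk P (X \<union> F \<times> T) \<le> cost (\<lambda>A. r (A \<union> F)) X"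
proof -
  have "X \<union> F \<times> T = F \<times> T \<union> X \<inter> UNIV \<times> T" using X by auto
  then show ?thesis
    using add_columns[OF finite_T order_refl, of "F \<times> T" F X] X F rk_full[OF F]
    by (auto simp: cost_def mult.commute)
qed

text \<open>
  Let \<open>E\<close> be the set of columns whose slice spans \<open>L\<close> or \<open>L'\<close>, and \<open>?X\<close> the part of \<open>X\<close> in these
  columns. Submodularity of \<open>?X \<union> L \<times> T\<close> and \<open>?X \<union> L' \<times> T\<close>, whose union has rank \<open>3 * k\<close>, gives
  the bound for \<open>?X\<close>, because \<open>meet_rk_le\<close> is an equality for slices that span one of the
  lines. On the other slices \<open>meet_rk\<close> is \<open>r + 1\<close>, so each of them contributes its own rank to the
  cost, and these columns can simply be added.
\<close>

lemma rk_le_cost_meet: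
  assumes X: "X \<subseteq> S \<times> T" and sk: "skew_lines L L'"
  shows "rk P X \<le> cost (meet_rk L L') X"
proof -
  note sub = skew_lines_subset[OF sk]
  have L: "r L = 2" "r L' = 2" using sk by (auto simp: skew_lines_def)
  define E where "E = {t \<in> T. spans (slice X t) L \<or> spans (slice X t) L'}"
  define D where "D = T - E"
  have fin: "finite E" "finite D" "E \<subseteq> T" "D \<subseteq> T" "E \<inter> D = {}" "T = E \<union> D"
    using finite_T by (auto simp: E_def D_def)
  let ?X = "X \<inter> UNIV \<times> E"
  have XE: "?X \<subseteq> S \<times> T" using X by auto
  have s: "slice X t \<subseteq> S" for t using slice_subset[OF X] .
  have bound: "rk P (?X \<union> F \<times> T) \<le> 2 * k + (\<Sum>t\<in>E. r (slice X t \<union> F) - 2)"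
    if F: "F \<subseteq> S" "r F = 2" for F
    using add_columns[OF fin(1,3), of "F \<times> T" F X] F X rk_full[OF F(1)] fin(3)
    by (auto simp: Un_commute)
  have "rk P ((?X \<union> L \<times> T) \<union> (?X \<union> L' \<times> T)) + rk P ((?X \<union> L \<times> T) \<inter> (?X \<union> L' \<times> T))
      \<le> rk P (?X \<union> L \<times> T) + rk P (?X \<union> L' \<times> T)"
    using X sub by (intro P.rk_submodular) (auto simp: ground_P)
  moreover have "rk P ((L \<union> L') \<times> T) \<le> rk P ((?X \<union> L \<times> T) \<union> (?X \<union> L' \<times> T))"
    using X sub by (intro P.rk_mono) (auto simp: ground_P)
  moreover have "rk P ?X \<le> rk P ((?X \<union> L \<times> T) \<inter> (?X \<union> L' \<times> T))"
    using X sub by (intro P.rk_mono) (auto simp: ground_P)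
  moreover have "rk P ((L \<union> L') \<times> T) = 3 * k"
    using rk_full[of "L \<union> L'"] sub skew_lines_span[OF sk] by simp
  moreover have "(\<Sum>t\<in>E. r (slice X t \<union> L) - 2) + (\<Sum>t\<in>E. r (slice X t \<union> L') - 2)
      = (\<Sum>t\<in>E. meet_rk L L' (slice X t) - 1)"
    unfolding sum.distrib[symmetric]
  proof (rule sum.cong[OF refl])
    fix t assume "t \<in> E"
    then have on: "spans (slice X t) L \<or> spans (slice X t) L'" by (simp add: E_def)
    let ?A = "slice X t"
    have "r (?A \<union> L \<union> L') = 3"
      using rk_mono[of "L \<union> L'" "?A \<union> L \<union> L'"] r_le_3[of "?A \<union> L \<union> L'"]
        skew_lines_span[OF sk] s sub by (auto simp: Un_assoc)
    moreover have "r (?A \<union> L \<union> L') + r ?A \<le> r (?A \<union> L) + r (?A \<union> L')"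
      using s sub by (intro r_submodular_le) auto
    moreover have "2 \<le> r (?A \<union> L)" "2 \<le> r (?A \<union> L')" "r (?A \<union> L) \<le> 3" "r (?A \<union> L') \<le> 3"
      using rk_mono[of L "?A \<union> L"] rk_mono[of L' "?A \<union> L'"] L s sub r_le_3 by auto
    ultimately show "r (?A \<union> L) - 2 + (r (?A \<union> L') - 2) = meet_rk L L' ?A - 1"
      using on by (auto simp: spans_def meet_rk_def)
  qed
  ultimately have "rk P ?X \<le> k + (\<Sum>t\<in>E. meet_rk L L' (slice X t) - 1)"
    using bound[OF sub(1) L(1)] bound[OF sub(2) L(2)] by linarith
  moreover have "rk P X \<le> rk P ?X + (\<Sum>t\<in>D. meet_rk L L' (slice X t) - 1)"
  proof -
    have "X = ?X \<union> X \<inter> UNIV \<times> D" using X fin by auto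
    then have "rk P X \<le> rk P ?X + (\<Sum>t\<in>D. r (slice X t))"
      using add_columns[OF fin(2,4) XE, of "{}" X] X by simp
    also have "(\<Sum>t\<in>D. r (slice X t)) = (\<Sum>t\<in>D. meet_rk L L' (slice X t) - 1)"
      by (intro sum.cong) (auto simp: D_def E_def meet_rk_def)
    finally show ?thesis .
  qed
  moreover have "cost (meet_rk L L') X = k + (\<Sum>t\<in>E. meet_rk L L' (slice X t) - 1)
      + (\<Sum>t\<in>D. meet_rk L L' (slice X t) - 1)"
    using sum.union_disjoint[OF fin(1,2,5)] by (simp add: cost_def meet_rk_empty[OF sk] flip: fin(6))
  ultimately show ?thesis by simp
qed

lemma rk_le_free_rk:
  assumes X: "X \<subseteq> S \<times> T"
  shows "rk P X \<le> free_rk X"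
using X
proof (cases rule: free_rk_attained_cases)
  case (flat F)
  have "F \<subseteq> S" using flat flat_subset by blast
  then have "rk P X \<le> rk P (X \<union> F \<times> T)"
    using X by (intro P.rk_mono) (auto simp: ground_P)
  then show ?thesis using rk_le_cost_subset[OF X \<open>F \<subseteq> S\<close>] flat by simp
next
  case (meet L L')
  then show ?thesis using rk_le_cost_meet[OF X] by simp
qed

end

theorem theorem6p1:
  fixes M :: "'a ranked_set" and N :: "'b ranked_set" and k n :: nat
  assumes "matroid M" and "matroid_rank M = 3"
    and "uniform_matroid k n N"
  shows "\<exists>P. freest_tensor_product M N P"
proof -
  have N: "finite (ground N)" "\<And>Y. Y \<subseteq> ground N \<Longrightarrow> rk N Y = min (card Y) k"
    "rk N (ground N) = k"
    using assms(3) by (auto simp: uniform_matroid_def matroid_rank_def matroid.finite_ground)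
  interpret rank3_columns M "ground N" k
    using assms N(1)
    by (simp add: rank3_columns_def rank3_columns_axioms_def rank3_matroid_def
        rank3_matroid_axioms_def)
  let ?P = "(S \<times> ground N, free_rk)"
  have "?P \<in> M \<otimes> N"
    using matroid_free_rk free_rk_product N(2) by (auto simp: tensor_products_def)
  moreover have "indep ?P X" if P: "P \<in> M \<otimes> N" and X: "indep P X" for P X
  proof -
    interpret rank3_columns_product M "ground N" k P
    proof (intro rank3_columns_product.intro rank3_columns_product_axioms.intro)
      show "matroid P" "ground P = S \<times> ground N"
        using P by (auto simp: tensor_products_def)
      show "rk P (A \<times> ground N) = r A * k" if "A \<subseteq> S" for A
        using P that N(3) by (auto simp: tensor_products_def)
      show "rk P (A \<times> {t}) = r A * min 1 k" if "A \<subseteq> S" "t \<in> ground N" for A t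
        using P that N(2)[of "{t}"] by (auto simp: tensor_products_def)
    qed (rule rank3_columns_axioms)
    have "X \<subseteq> S \<times> ground N" "rk P X = card X"
      using X by (auto simp: indep_def ground_P)
    then show ?thesis
      using rk_le_free_rk[of X] free_rk_le_card[of X] by (simp add: indep_def)
  qed
  ultimately show ?thesis unfolding freest_tensor_product_def by blast
qed

end
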